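(* Let $R$ be a ring, $\mathcal X$ an enveloping class of right $R$-modules, and $M$ an indecomposable $\mathcal X$-automorphism invariant right $R$-module with a monomorphic $\mathcal X$-envelope $u:M\to X$ such that $\mathrm{End}(X)/J(\mathrm{End}(X))$ is von Neumann regular right self-injective and idempotents lift modulo $J(\mathrm{End}(X))$. Then the following statements are equivalent: (1) $M$ is $\mathcal X$-endomorphism invariant; (2) $X$ is indecomposable.
   Context: Rings are associative with identity, modules are unitary right modules, and $J(\cdot)$ denotes the Jacobson radical. A class $\mathcal X$ of right $R$-modules closed under isomorphisms is an enveloping class if every right $R$-module $M$ has an $\mathcal X$-envelope, i.e. a homomorphism $u:M\to X$ with $X\in\mathcal X$ such that every homomorphism from $M$ to a module in $\mathcal X$ factors through $u$, and every endomorphism $h$ of $X$ with $u=h\circ u$ is an automorphism. The envelope is monomorphic if $u$ is a monomorphism. A module $M$ with $\mathcal X$-envelope $u:M\to X$ is $\mathcal X$-automorphism invariant (respectively $\mathcal X$-endomorphism invariant) if for every automorphism (respectively endomorphism) $g$ of $X$ there is an endomorphism $f$ of $M$ with $g\circ u=u\circ f$. *)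

theory Defs
  imports "HOL-Algebra.Module" "HOL-Algebra.QuotRing"
begin

section \<open>Right modules over a noncommutative ring\<close>

text \<open>
  The locale \<^locale>\<open>module\<close> is about modules over commutative rings, but its record type and the
  locale \<^locale>\<open>submodule\<close> do not depend on commutativity and are reused here. For a right module,
  \<open>r \<odot>\<^bsub>M\<^esub> x\<close> stands for what is written \<open>x r\<close> on paper; hence the order of the factors in
  \<open>ract_assoc\<close>.
\<close>

locale right_module = R?: ring R + M?: abelian_group M
  for R :: "('a, 'c) ring_scheme" (structure) and M :: "('a, 'b, 'd) module_scheme" (structure) +
  assumes ract_closed:
      "\<lbrakk>r \<in> carrier R; x \<in> carrier M\<rbrakk> \<Longrightarrow> r \<odot>\<^bsub>M\<^esub> x \<in> carrier M"
    and ract_distr_ring: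
      "\<lbrakk>r \<in> carrier R; s \<in> carrier R; x \<in> carrier M\<rbrakk> \<Longrightarrow>
        (r \<oplus>\<^bsub>R\<^esub> s) \<odot>\<^bsub>M\<^esub> x = r \<odot>\<^bsub>M\<^esub> x \<oplus>\<^bsub>M\<^esub> s \<odot>\<^bsub>M\<^esub> x"
    and ract_distr_module:
      "\<lbrakk>r \<in> carrier R; x \<in> carrier M; y \<in> carrier M\<rbrakk> \<Longrightarrow>
        r \<odot>\<^bsub>M\<^esub> (x \<oplus>\<^bsub>M\<^esub> y) = r \<odot>\<^bsub>M\<^esub> x \<oplus>\<^bsub>M\<^esub> r \<odot>\<^bsub>M\<^esub> y"
    and ract_assoc:
      "\<lbrakk>r \<in> carrier R; s \<in> carrier R; x \<in> carrier M\<rbrakk> \<Longrightarrow>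
        (r \<otimes>\<^bsub>R\<^esub> s) \<odot>\<^bsub>M\<^esub> x = s \<odot>\<^bsub>M\<^esub> (r \<odot>\<^bsub>M\<^esub> x)"
    and ract_one:
      "x \<in> carrier M \<Longrightarrow> \<one>\<^bsub>R\<^esub> \<odot>\<^bsub>M\<^esub> x = x"

text \<open>Values outside the carrier are irrelevant, as for \<^const>\<open>hom\<close> and \<^const>\<open>ring_hom\<close>.\<close>

definition rmod_hom ::
  "('a, 'c) ring_scheme \<Rightarrow> ('a, 'm, 'd) module_scheme \<Rightarrow> ('a, 'n, 'e) module_scheme \<Rightarrow> ('m \<Rightarrow> 'n) set"
  where "rmod_hom R M N =
    {f \<in> carrier M \<rightarrow> carrier N.
      (\<forall>x\<in>carrier M. \<forall>y\<in>carrier M. f (x \<oplus>\<^bsub>M\<^esub> y) = f x \<oplus>\<^bsub>N\<^esub> f y) \<and>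
      (\<forall>r\<in>carrier R. \<forall>x\<in>carrier M. f (r \<odot>\<^bsub>M\<^esub> x) = r \<odot>\<^bsub>N\<^esub> f x)}"

definition rmod_iso ::
  "('a, 'c) ring_scheme \<Rightarrow> ('a, 'm, 'd) module_scheme \<Rightarrow> ('a, 'n, 'e) module_scheme \<Rightarrow> ('m \<Rightarrow> 'n) set"
  where "rmod_iso R M N = {f \<in> rmod_hom R M N. bij_betw f (carrier M) (carrier N)}"

abbreviation rmod_endo :: "('a, 'c) ring_scheme \<Rightarrow> ('a, 'm, 'd) module_scheme \<Rightarrow> ('m \<Rightarrow> 'm) set"
  where "rmod_endo R M \<equiv> rmod_hom R M M"

abbreviation rmod_auto :: "('a, 'c) ring_scheme \<Rightarrow> ('a, 'm, 'd) module_scheme \<Rightarrow> ('m \<Rightarrow> 'm) set"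
  where "rmod_auto R M \<equiv> rmod_iso R M M"

definition indecomposable_module ::
  "('a, 'c) ring_scheme \<Rightarrow> ('a, 'm, 'd) module_scheme \<Rightarrow> bool"
  where "indecomposable_module R M \<longleftrightarrow>
    carrier M \<noteq> {\<zero>\<^bsub>M\<^esub>} \<and>
    (\<forall>A B. submodule A R M \<and> submodule B R M \<and>
        A <+>\<^bsub>M\<^esub> B = carrier M \<and> A \<inter> B = {\<zero>\<^bsub>M\<^esub>}
      \<longrightarrow> A = {\<zero>\<^bsub>M\<^esub>} \<or> B = {\<zero>\<^bsub>M\<^esub>})"

text \<open>
  Elements are the endomorphisms normalised to \<^const>\<open>undefined\<close> outside the carrier, so that equality
  of ring elements is equality of endomorphisms; the product of \<open>g\<close> and \<open>f\<close> is \<open>g\<close> after \<open>f\<close>.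
\<close>

definition End_ring ::
  "('a, 'c) ring_scheme \<Rightarrow> ('a, 'm, 'd) module_scheme \<Rightarrow> ('m \<Rightarrow> 'm) ring"
  where "End_ring R M =
    \<lparr>carrier = rmod_endo R M \<inter> extensional (carrier M),
     mult = (\<lambda>g f. compose (carrier M) g f),
     one = (\<lambda>x\<in>carrier M. x),
     zero = (\<lambda>x\<in>carrier M. \<zero>\<^bsub>M\<^esub>),
     add = (\<lambda>f g. \<lambda>x\<in>carrier M. f x \<oplus>\<^bsub>M\<^esub> g x)\<rparr>"

section \<open>Ring-theoretic notions\<close>

definition regular_right_module :: "('s, 'c) ring_scheme \<Rightarrow> ('s, 's) module"
  where "regular_right_module S =
    \<lparr>carrier = carrier S, mult = mult S, one = one S,
     zero = zero S, add = add S,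
     smult = (\<lambda>r x. x \<otimes>\<^bsub>S\<^esub> r)\<rparr>"

abbreviation right_ideal :: "'s set \<Rightarrow> ('s, 'c) ring_scheme \<Rightarrow> bool"
  where "right_ideal I S \<equiv> submodule I S (regular_right_module S)"

definition maximal_right_ideal :: "'s set \<Rightarrow> ('s, 'c) ring_scheme \<Rightarrow> bool"
  where "maximal_right_ideal I S \<longleftrightarrow>
    right_ideal I S \<and> I \<noteq> carrier S \<and>
    (\<forall>K. right_ideal K S \<and> I \<subseteq> K \<longrightarrow> K = I \<or> K = carrier S)"

definition jacobson_radical :: "('s, 'c) ring_scheme \<Rightarrow> 's set"
  where "jacobson_radical S = {x \<in> carrier S. \<forall>I. maximal_right_ideal I S \<longrightarrow> x \<in> I}"

definition von_neumann_regular :: "('s, 'c) ring_scheme \<Rightarrow> bool"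
  where "von_neumann_regular S \<longleftrightarrow>
    (\<forall>a\<in>carrier S. \<exists>b\<in>carrier S. a \<otimes>\<^bsub>S\<^esub> b \<otimes>\<^bsub>S\<^esub> a = a)"

text \<open>
  Injectivity of \<open>S\<close> as a right module over itself. HOL cannot quantify over the carrier types of the
  test modules \<open>A\<close> and \<open>B\<close>; they range over all modules on the element type of \<open>S\<close>. Since these
  include \<open>S\<close> and its right ideals, Baer's criterion shows that nothing is lost.
\<close>

definition right_self_injective :: "('s, 'c) ring_scheme \<Rightarrow> bool"
  where "right_self_injective S \<longleftrightarrow>
    (\<forall>(A :: ('s, 's) module) (B :: ('s, 's) module) i f.
      right_module S A \<and> right_module S B \<and>
      i \<in> rmod_hom S A B \<and> inj_on i (carrier A) \<and>
      f \<in> rmod_hom S A (regular_right_module S)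
      \<longrightarrow> (\<exists>g\<in>rmod_hom S B (regular_right_module S). \<forall>x\<in>carrier A. g (i x) = f x))"

definition idempotents_lift_modulo :: "('s, 'c) ring_scheme \<Rightarrow> 's set \<Rightarrow> bool"
  where "idempotents_lift_modulo S J \<longleftrightarrow>
    (\<forall>a\<in>carrier S. a \<otimes>\<^bsub>S\<^esub> a \<ominus>\<^bsub>S\<^esub> a \<in> J \<longrightarrow>
      (\<exists>e\<in>carrier S. e \<otimes>\<^bsub>S\<^esub> e = e \<and> e \<ominus>\<^bsub>S\<^esub> a \<in> J))"

section \<open>Envelopes\<close>

definition closed_under_iso ::
  "('a, 'c) ring_scheme \<Rightarrow> ('a, 'x) module set \<Rightarrow> bool"
  where "closed_under_iso R \<X> \<longleftrightarrow>
    (\<forall>X\<in>\<X>. \<forall>Y :: ('a, 'x) module. right_module R Y \<and> rmod_iso R X Y \<noteq> {} \<longrightarrow> Y \<in> \<X>)"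

definition is_envelope ::
  "('a, 'c) ring_scheme \<Rightarrow> ('a, 'x) module set \<Rightarrow>
    ('a, 'm) module \<Rightarrow> ('a, 'x) module \<Rightarrow> ('m \<Rightarrow> 'x) \<Rightarrow> bool"
  where "is_envelope R \<X> M X u \<longleftrightarrow>
    X \<in> \<X> \<and> u \<in> rmod_hom R M X \<and>
    (\<forall>Y\<in>\<X>. \<forall>f\<in>rmod_hom R M Y. \<exists>g\<in>rmod_hom R X Y. \<forall>x\<in>carrier M. f x = g (u x)) \<and>
    (\<forall>h\<in>rmod_endo R X. (\<forall>x\<in>carrier M. u x = h (u x)) \<longrightarrow> h \<in> rmod_auto R X)"

text \<open>
  The modules of the class live on a type \<open>'x\<close>, and envelopes are required for the modules on a
  type \<open>'m\<close>. Keeping the two types apart covers classes whose envelopes are larger than the modules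
  they envelop; \<open>'x = 'm\<close> is allowed.
\<close>

definition enveloping_class ::
  "'m itself \<Rightarrow> ('a, 'c) ring_scheme \<Rightarrow> ('a, 'x) module set \<Rightarrow> bool"
  where "enveloping_class (_ :: 'm itself) R \<X> \<longleftrightarrow>
    (\<forall>X\<in>\<X>. right_module R X) \<and> closed_under_iso R \<X> \<and>
    (\<forall>M :: ('a, 'm) module. right_module R M \<longrightarrow> (\<exists>X u. is_envelope R \<X> M X u))"

text \<open>
  Invariance of \<open>M\<close> with respect to the envelope \<open>u : M \<rightarrow> X\<close>; the class enters only through the
  requirement that \<open>u\<close> be an envelope.
\<close>

definition automorphism_invariant ::
  "('a, 'c) ring_scheme \<Rightarrow> ('a, 'x) module set \<Rightarrow>
    ('a, 'm) module \<Rightarrow> ('a, 'x) module \<Rightarrow> ('m \<Rightarrow> 'x) \<Rightarrow> bool"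
  where "automorphism_invariant R \<X> M X u \<longleftrightarrow>
    is_envelope R \<X> M X u \<and>
    (\<forall>g\<in>rmod_auto R X. \<exists>f\<in>rmod_endo R M. \<forall>x\<in>carrier M. g (u x) = u (f x))"

definition endomorphism_invariant ::
  "('a, 'c) ring_scheme \<Rightarrow> ('a, 'x) module set \<Rightarrow>
    ('a, 'm) module \<Rightarrow> ('a, 'x) module \<Rightarrow> ('m \<Rightarrow> 'x) \<Rightarrow> bool"
  where "endomorphism_invariant R \<X> M X u \<longleftrightarrow>
    is_envelope R \<X> M X u \<and>
    (\<forall>g\<in>rmod_endo R X. \<exists>f\<in>rmod_endo R M. \<forall>x\<in>carrier M. g (u x) = u (f x))"

end

theory Submission
  imports Defs
begin

text \<open>
  If \<open>M\<close> is endomorphism invariant, the projections belonging to a decomposition of \<open>X\<close> restrict to \<open>M\<close>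
  and decompose it; so \<open>M\<close> lies in one of the summands, and the projection onto that summand fixes \<open>M\<close>
  and is therefore an automorphism by the envelope property. Conversely, if \<open>X\<close> is indecomposable,
  then \<open>S = End(X)\<close> has only trivial idempotents. They lift modulo the radical, so the von Neumann regular
  ring \<open>S/J(S)\<close> has only trivial idempotents as well, i.e. it is a division ring, and \<open>S\<close> is local. Hence
  for every \<open>g\<close> in \<open>S\<close> one of \<open>g\<close> and \<open>1 - g\<close> is an automorphism, and either of them leaving \<open>M\<close>
  invariant makes \<open>g\<close> leave \<open>M\<close> invariant.
\<close>

section \<open>Right modules\<close>

text \<open>Lets the two summands of a decomposition trade places, so that a statement about one
  summand can also be applied to the other.\<close>

lemma (in abelian_group) set_add_commute:
  assumes "A \<subseteq> carrier G" "B \<subseteq> carrier G"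
  shows "A <+>\<^bsub>G\<^esub> B = B <+>\<^bsub>G\<^esub> A"
proof -
  have "a \<oplus> b = b \<oplus> a" if "a \<in> A" "b \<in> B" for a b
    using that assms a_comm by blast
  then have "(\<Union>b\<in>B. \<Union>a\<in>A. {b \<oplus> a}) = (\<Union>b\<in>B. \<Union>a\<in>A. {a \<oplus> b})"
    by simp
  also have "\<dots> = (\<Union>a\<in>A. \<Union>b\<in>B. {a \<oplus> b})"
    by blast
  finally show ?thesis by (simp add: set_add_def')
qed

context right_module
begin

lemma ract_zero:
  assumes "r \<in> carrier R"
  shows "r \<odot>\<^bsub>M\<^esub> \<zero>\<^bsub>M\<^esub> = \<zero>\<^bsub>M\<^esub>"
proof -
  have "r \<odot>\<^bsub>M\<^esub> \<zero>\<^bsub>M\<^esub> \<oplus>\<^bsub>M\<^esub> r \<odot>\<^bsub>M\<^esub> \<zero>\<^bsub>M\<^esub> = r \<odot>\<^bsub>M\<^esub> \<zero>\<^bsub>M\<^esub>"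
    using ract_distr_module[of r "\<zero>\<^bsub>M\<^esub>" "\<zero>\<^bsub>M\<^esub>"] assms by simp
  then show ?thesis
    using M.add.l_cancel_one[of "r \<odot>\<^bsub>M\<^esub> \<zero>\<^bsub>M\<^esub>" "r \<odot>\<^bsub>M\<^esub> \<zero>\<^bsub>M\<^esub>"] ract_closed assms by simp
qed

lemma submoduleI:
  assumes "H \<subseteq> carrier M" "\<zero>\<^bsub>M\<^esub> \<in> H"
    and "\<And>x. x \<in> H \<Longrightarrow> \<ominus>\<^bsub>M\<^esub> x \<in> H"
    and "\<And>x y. \<lbrakk>x \<in> H; y \<in> H\<rbrakk> \<Longrightarrow> x \<oplus>\<^bsub>M\<^esub> y \<in> H"
    and "\<And>r x. \<lbrakk>r \<in> carrier R; x \<in> H\<rbrakk> \<Longrightarrow> r \<odot>\<^bsub>M\<^esub> x \<in> H"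
  shows "submodule H R M"
  using assms
  by (intro submodule.intro subgroup.intro) (simp_all add: submodule_axioms_def a_inv_def)

lemma submoduleD:
  assumes "submodule H R M"
  shows "H \<subseteq> carrier M" "\<zero>\<^bsub>M\<^esub> \<in> H"
    and "\<And>x. x \<in> H \<Longrightarrow> \<ominus>\<^bsub>M\<^esub> x \<in> H"
    and "\<And>x y. \<lbrakk>x \<in> H; y \<in> H\<rbrakk> \<Longrightarrow> x \<oplus>\<^bsub>M\<^esub> y \<in> H"
    and "\<And>r x. \<lbrakk>r \<in> carrier R; x \<in> H\<rbrakk> \<Longrightarrow> r \<odot>\<^bsub>M\<^esub> x \<in> H"
proof -
  interpret H: submodule H R M by (rule assms)
  show "H \<subseteq> carrier M" "\<zero>\<^bsub>M\<^esub> \<in> H"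
    using H.subset H.one_closed by simp_all
  show "\<And>x. x \<in> H \<Longrightarrow> \<ominus>\<^bsub>M\<^esub> x \<in> H"
    using H.m_inv_closed by (simp add: a_inv_def)
  show "\<And>x y. \<lbrakk>x \<in> H; y \<in> H\<rbrakk> \<Longrightarrow> x \<oplus>\<^bsub>M\<^esub> y \<in> H"
    using H.m_closed by simp
  show "\<And>r x. \<lbrakk>r \<in> carrier R; x \<in> H\<rbrakk> \<Longrightarrow> r \<odot>\<^bsub>M\<^esub> x \<in> H"
    by simp
qed

lemma submodule_minus_closed:
  assumes "submodule H R M" "x \<in> H" "y \<in> H"
  shows "x \<ominus>\<^bsub>M\<^esub> y \<in> H"
  using submoduleD(3,4)[OF assms(1)] assms(2,3) by (simp add: a_minus_def)

lemma minus_add_cancel: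
  assumes "x \<in> carrier M" "y \<in> carrier M"
  shows "(x \<ominus>\<^bsub>M\<^esub> y) \<oplus>\<^bsub>M\<^esub> y = x"
  using assms by (simp add: a_minus_def M.a_assoc M.l_neg)

lemma minus_eq_zero_iff:
  assumes "x \<in> carrier M" "y \<in> carrier M"
  shows "x \<ominus>\<^bsub>M\<^esub> y = \<zero>\<^bsub>M\<^esub> \<longleftrightarrow> x = y"
  by (metis M.l_zero M.minus_closed M.r_neg M.minus_eq assms minus_add_cancel)

end

section \<open>Homomorphisms of right modules, preimages and images of submodules\<close>

lemma rmod_homD:
  assumes "f \<in> rmod_hom R M N"
  shows "\<And>x. x \<in> carrier M \<Longrightarrow> f x \<in> carrier N"
    and "\<And>x y. \<lbrakk>x \<in> carrier M; y \<in> carrier M\<rbrakk> \<Longrightarrow> f (x \<oplus>\<^bsub>M\<^esub> y) = f x \<oplus>\<^bsub>N\<^esub> f y"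
    and "\<And>r x. \<lbrakk>r \<in> carrier R; x \<in> carrier M\<rbrakk> \<Longrightarrow> f (r \<odot>\<^bsub>M\<^esub> x) = r \<odot>\<^bsub>N\<^esub> f x"
  using assms by (auto simp: rmod_hom_def)

lemma rmod_homI:
  assumes "\<And>x. x \<in> carrier M \<Longrightarrow> f x \<in> carrier N"
    and "\<And>x y. \<lbrakk>x \<in> carrier M; y \<in> carrier M\<rbrakk> \<Longrightarrow> f (x \<oplus>\<^bsub>M\<^esub> y) = f x \<oplus>\<^bsub>N\<^esub> f y"
    and "\<And>r x. \<lbrakk>r \<in> carrier R; x \<in> carrier M\<rbrakk> \<Longrightarrow> f (r \<odot>\<^bsub>M\<^esub> x) = r \<odot>\<^bsub>N\<^esub> f x"
  shows "f \<in> rmod_hom R M N"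
  using assms by (auto simp: rmod_hom_def)

locale right_module_hom = M: right_module R M + N: right_module R N
  for R :: "('a, 'c) ring_scheme" and M :: "('a, 'm, 'd) module_scheme"
    and N :: "('a, 'n, 'e) module_scheme" +
  fixes f
  assumes hom: "f \<in> rmod_hom R M N"
begin

lemmas hom_closed = rmod_homD(1)[OF hom]
  and hom_add = rmod_homD(2)[OF hom]
  and hom_smult = rmod_homD(3)[OF hom]

lemma hom_zero: "f \<zero>\<^bsub>M\<^esub> = \<zero>\<^bsub>N\<^esub>"
proof -
  have "f \<zero>\<^bsub>M\<^esub> \<oplus>\<^bsub>N\<^esub> f \<zero>\<^bsub>M\<^esub> = f \<zero>\<^bsub>M\<^esub>"
    using hom_add[of "\<zero>\<^bsub>M\<^esub>" "\<zero>\<^bsub>M\<^esub>"] by simp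
  then show ?thesis
    using N.M.add.l_cancel_one[of "f \<zero>\<^bsub>M\<^esub>" "f \<zero>\<^bsub>M\<^esub>"] hom_closed by simp
qed

lemma hom_neg:
  assumes "x \<in> carrier M"
  shows "f (\<ominus>\<^bsub>M\<^esub> x) = \<ominus>\<^bsub>N\<^esub> f x"
proof -
  have "f (\<ominus>\<^bsub>M\<^esub> x) \<oplus>\<^bsub>N\<^esub> f x = \<zero>\<^bsub>N\<^esub>"
    using hom_add[of "\<ominus>\<^bsub>M\<^esub> x" x] assms by (simp add: M.M.l_neg hom_zero)
  then show ?thesis
    using N.M.minus_equality hom_closed assms by simp
qed

lemma hom_minus:
  assumes "x \<in> carrier M" "y \<in> carrier M"
  shows "f (x \<ominus>\<^bsub>M\<^esub> y) = f x \<ominus>\<^bsub>N\<^esub> f y"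
  using assms by (simp add: a_minus_def hom_add hom_neg)

lemma submodule_vimage:
  assumes "submodule H R N"
  shows "submodule {x \<in> carrier M. f x \<in> H} R M"
  by (rule M.submoduleI)
    (auto simp: hom_zero hom_neg hom_add hom_smult M.ract_closed N.submoduleD[OF assms])

lemma submodule_image: "submodule (f ` carrier M) R N"
proof (rule N.submoduleI)
  show "\<zero>\<^bsub>N\<^esub> \<in> f ` carrier M"
    using hom_zero M.M.zero_closed by (intro image_eqI[of _ f "\<zero>\<^bsub>M\<^esub>"]) simp_all
  show "\<ominus>\<^bsub>N\<^esub> y \<in> f ` carrier M" if "y \<in> f ` carrier M" for y
    using that by (auto simp flip: hom_neg)
  show "y \<oplus>\<^bsub>N\<^esub> z \<in> f ` carrier M" if "y \<in> f ` carrier M" "z \<in> f ` carrier M" for y z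
    using that by (auto simp flip: hom_add)
  show "r \<odot>\<^bsub>N\<^esub> y \<in> f ` carrier M" if "r \<in> carrier R" "y \<in> f ` carrier M" for r y
    using that by (auto simp: M.ract_closed simp flip: hom_smult)
qed (auto simp: hom_closed)

end

section \<open>Direct sum decompositions and their projections\<close>

context right_module
begin

lemma zero_submodule: "submodule {\<zero>\<^bsub>M\<^esub>} R M"
  by (rule submoduleI) (auto simp: ract_zero)

text \<open>The sum condition gives each element a component in \<open>A\<close>, and the trivial
  intersection makes that component unique. Linearity of \<open>p\<close> then comes from
  uniqueness: adding decompositions, or acting on one by a scalar, again yields a
  decomposition.\<close>

lemma direct_sum_projection:
  assumes A: "submodule A R M" and B: "submodule B R M"
    and sum: "A <+>\<^bsub>M\<^esub> B = carrier M" and int: "A \<inter> B = {\<zero>\<^bsub>M\<^esub>}"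
  shows "\<exists>p\<in>rmod_endo R M. (\<forall>x\<in>carrier M. p x \<in> A \<and> x \<ominus>\<^bsub>M\<^esub> p x \<in> B) \<and>
    (\<forall>x\<in>A. p x = x) \<and> (\<forall>x\<in>B. p x = \<zero>\<^bsub>M\<^esub>)"
proof -
  note AD = submoduleD[OF A] and BD = submoduleD[OF B]
  have "\<forall>x\<in>carrier M. \<exists>a. a \<in> A \<and> x \<ominus>\<^bsub>M\<^esub> a \<in> B"
  proof
    fix x assume "x \<in> carrier M"
    then obtain a b where ab: "a \<in> A" "b \<in> B" "x = a \<oplus>\<^bsub>M\<^esub> b"
      unfolding sum[symmetric] set_add_def' by auto
    then have "a \<in> carrier M" "b \<in> carrier M" using AD(1) BD(1) by auto
    then have "x \<ominus>\<^bsub>M\<^esub> a = b"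
      by (simp add: ab(3) a_minus_def M.a_comm[of a b] M.a_assoc M.r_neg)
    then show "\<exists>a. a \<in> A \<and> x \<ominus>\<^bsub>M\<^esub> a \<in> B" using ab by auto
  qed
  \<comment> \<open>At this point \<open>p\<close> is only a choice of an \<open>A\<close>-component
    for each element; nothing yet says that the choices fit together.\<close>
  then obtain p where p: "\<And>x. x \<in> carrier M \<Longrightarrow> p x \<in> A \<and> x \<ominus>\<^bsub>M\<^esub> p x \<in> B"
    by (auto simp: bchoice_iff)
  then have pc: "\<And>x. x \<in> carrier M \<Longrightarrow> p x \<in> carrier M"
    using AD(1) by auto
  have uniq: "p (a \<oplus>\<^bsub>M\<^esub> b) = a" if "a \<in> A" "b \<in> B" for a b
  proof -
    have c: "a \<in> carrier M" "b \<in> carrier M" using that AD(1) BD(1) by auto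
    let ?x = "a \<oplus>\<^bsub>M\<^esub> b"
    have x: "?x \<in> carrier M" using c by simp
    \<comment> \<open>Two decompositions of \<open>?x\<close> are compared: the difference of their
      \<open>A\<close>-components equals the difference of their \<open>B\<close>-components, so it
      lies in both submodules.\<close>
    have "p ?x \<ominus>\<^bsub>M\<^esub> a = b \<ominus>\<^bsub>M\<^esub> (?x \<ominus>\<^bsub>M\<^esub> p ?x)"
      using c pc[OF x] by (simp add: a_minus_def M.minus_add M.a_assoc M.r_neg2
          M.a_lcomm[of b "\<ominus>\<^bsub>M\<^esub> a"] M.a_comm[of "p ?x"])
    moreover have "p ?x \<ominus>\<^bsub>M\<^esub> a \<in> A"
      using that p[OF x] submodule_minus_closed[OF A] by blast
    moreover have "b \<ominus>\<^bsub>M\<^esub> (?x \<ominus>\<^bsub>M\<^esub> p ?x) \<in> B"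
      using that p[OF x] submodule_minus_closed[OF B] by blast
    ultimately have "p ?x \<ominus>\<^bsub>M\<^esub> a \<in> A \<inter> B"
      by (metis IntI)
    then show ?thesis
      using int minus_eq_zero_iff[OF pc[OF x] c(1)] by auto
  qed
  have split: "x = p x \<oplus>\<^bsub>M\<^esub> (x \<ominus>\<^bsub>M\<^esub> p x)" if "x \<in> carrier M" for x
    using that pc minus_add_cancel[of x "p x"] M.a_comm[of "p x" "x \<ominus>\<^bsub>M\<^esub> p x"] by simp
  show ?thesis
  proof (intro bexI[of _ p] conjI ballI)
    show "p \<in> rmod_endo R M"
    proof (rule rmod_homI)
      fix x y assume xy: "x \<in> carrier M" "y \<in> carrier M"
      have "x \<oplus>\<^bsub>M\<^esub> y = (p x \<oplus>\<^bsub>M\<^esub> (x \<ominus>\<^bsub>M\<^esub> p x)) \<oplus>\<^bsub>M\<^esub> (p y \<oplus>\<^bsub>M\<^esub> (y \<ominus>\<^bsub>M\<^esub> p y))"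
        using split xy by simp
      also have "\<dots> = (p x \<oplus>\<^bsub>M\<^esub> p y) \<oplus>\<^bsub>M\<^esub> ((x \<ominus>\<^bsub>M\<^esub> p x) \<oplus>\<^bsub>M\<^esub> (y \<ominus>\<^bsub>M\<^esub> p y))"
        using xy pc M.minus_closed by (simp add: M.a_ac)
      finally show "p (x \<oplus>\<^bsub>M\<^esub> y) = p x \<oplus>\<^bsub>M\<^esub> p y"
        using uniq[of "p x \<oplus>\<^bsub>M\<^esub> p y" "(x \<ominus>\<^bsub>M\<^esub> p x) \<oplus>\<^bsub>M\<^esub> (y \<ominus>\<^bsub>M\<^esub> p y)"] p xy AD(4) BD(4) by simp
    next
      fix r x assume rx: "r \<in> carrier R" "x \<in> carrier M"
      have "r \<odot>\<^bsub>M\<^esub> x = r \<odot>\<^bsub>M\<^esub> (p x \<oplus>\<^bsub>M\<^esub> (x \<ominus>\<^bsub>M\<^esub> p x))"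
        using split rx by simp
      also have "\<dots> = r \<odot>\<^bsub>M\<^esub> p x \<oplus>\<^bsub>M\<^esub> r \<odot>\<^bsub>M\<^esub> (x \<ominus>\<^bsub>M\<^esub> p x)"
        using ract_distr_module rx pc M.minus_closed by simp
      finally show "p (r \<odot>\<^bsub>M\<^esub> x) = r \<odot>\<^bsub>M\<^esub> p x"
        using uniq[of "r \<odot>\<^bsub>M\<^esub> p x" "r \<odot>\<^bsub>M\<^esub> (x \<ominus>\<^bsub>M\<^esub> p x)"] p rx AD(5) BD(5) by simp
    qed (rule pc)
    show "p x = x" if "x \<in> A" for x
      using uniq[of x "\<zero>\<^bsub>M\<^esub>"] that AD(1) BD(2) by auto
    show "p x = \<zero>\<^bsub>M\<^esub>" if "x \<in> B" for x
      using uniq[of "\<zero>\<^bsub>M\<^esub>" x] that AD(2) BD(1) by auto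
  qed (use p in auto)
qed

end

lemma indecomposable_moduleD:
  assumes "indecomposable_module R M" "submodule A R M" "submodule B R M"
    and "A <+>\<^bsub>M\<^esub> B = carrier M" "A \<inter> B = {\<zero>\<^bsub>M\<^esub>}"
  shows "A = {\<zero>\<^bsub>M\<^esub>} \<or> B = {\<zero>\<^bsub>M\<^esub>}"
  using assms unfolding indecomposable_module_def by simp

section \<open>Endomorphism rings\<close>

context right_module
begin

lemma End_ring_memI:
  assumes "f \<in> rmod_endo R M"
  shows "restrict f (carrier M) \<in> carrier (End_ring R M)"
  using assms ract_closed by (auto simp: End_ring_def rmod_hom_def)

lemma End_ring_memD:
  assumes "f \<in> carrier (End_ring R M)"
  shows "f \<in> rmod_endo R M" "f \<in> extensional (carrier M)"
  using assms by (auto simp: End_ring_def)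

lemma End_ring_apply:
  assumes "x \<in> carrier M"
  shows "(g \<otimes>\<^bsub>End_ring R M\<^esub> f) x = g (f x)"
    and "(g \<oplus>\<^bsub>End_ring R M\<^esub> f) x = g x \<oplus>\<^bsub>M\<^esub> f x"
    and "\<one>\<^bsub>End_ring R M\<^esub> x = x"
    and "\<zero>\<^bsub>End_ring R M\<^esub> x = \<zero>\<^bsub>M\<^esub>"
  using assms by (simp_all add: End_ring_def compose_def)

lemma End_ring_eqI:
  assumes "f \<in> carrier (End_ring R M)" "g \<in> carrier (End_ring R M)"
    and "\<And>x. x \<in> carrier M \<Longrightarrow> f x = g x"
  shows "f = g"
  using extensionalityI assms End_ring_memD(2) by metis

text \<open>All operations act pointwise on the carrier and their values are extensional, so each
  ring law reduces to a law in \<open>M\<close> or to linearity of the maps.\<close>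

lemma End_ring_ring: "ring (End_ring R M)"
proof -
  let ?S = "End_ring R M"
  note D = rmod_homD[OF End_ring_memD(1)]
  have ext: "g \<otimes>\<^bsub>?S\<^esub> f \<in> extensional (carrier M)" "g \<oplus>\<^bsub>?S\<^esub> f \<in> extensional (carrier M)"
    "\<one>\<^bsub>?S\<^esub> \<in> extensional (carrier M)" "\<zero>\<^bsub>?S\<^esub> \<in> extensional (carrier M)" for f g
    by (simp_all add: End_ring_def)
  have memI: "f \<in> carrier ?S" if "f \<in> extensional (carrier M)" "f \<in> rmod_endo R M" for f
    using that by (simp add: End_ring_def)
  have mult: "g \<otimes>\<^bsub>?S\<^esub> f \<in> carrier ?S" if "g \<in> carrier ?S" "f \<in> carrier ?S" for f g
    using that by (intro memI ext rmod_homI) (simp_all add: End_ring_apply D ract_closed)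
  have add: "g \<oplus>\<^bsub>?S\<^esub> f \<in> carrier ?S" if "g \<in> carrier ?S" "f \<in> carrier ?S" for f g
    using that by (intro memI ext rmod_homI)
      (simp_all add: End_ring_apply D ract_closed M.a_ac ract_distr_module)
  have one: "\<one>\<^bsub>?S\<^esub> \<in> carrier ?S"
    by (intro memI ext rmod_homI) (simp_all add: End_ring_apply ract_closed)
  have zero: "\<zero>\<^bsub>?S\<^esub> \<in> carrier ?S"
    by (intro memI ext rmod_homI) (simp_all add: End_ring_apply ract_closed ract_zero)
  have inv: "\<exists>g\<in>carrier ?S. g \<oplus>\<^bsub>?S\<^esub> f = \<zero>\<^bsub>?S\<^esub>" if f: "f \<in> carrier ?S" for f
  proof -
    \<comment> \<open>The action commutes with additive inverses, by uniqueness of the inverse. This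
      makes the pointwise negative of an endomorphism linear.\<close>
    have neg: "r \<odot>\<^bsub>M\<^esub> (\<ominus>\<^bsub>M\<^esub> x) = \<ominus>\<^bsub>M\<^esub> (r \<odot>\<^bsub>M\<^esub> x)"
      if "r \<in> carrier R" "x \<in> carrier M" for r x
      using M.minus_equality ract_distr_module[of r "\<ominus>\<^bsub>M\<^esub> x" x] that
      by (simp add: ract_closed ract_zero M.l_neg)
    let ?g = "\<lambda>x\<in>carrier M. \<ominus>\<^bsub>M\<^esub> f x"
    have g: "?g \<in> carrier ?S"
      using f by (intro memI rmod_homI)
        (simp_all add: D ract_closed M.minus_add M.a_comm neg)
    moreover have "?g \<oplus>\<^bsub>?S\<^esub> f = \<zero>\<^bsub>?S\<^esub>"
      using f g by (intro End_ring_eqI add zero) (simp_all add: End_ring_apply D M.l_neg)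
    ultimately show ?thesis by blast
  qed
  show ?thesis
  proof (rule ringI)
    show "abelian_group ?S"
      by (rule abelian_groupI)
        (auto intro!: End_ring_eqI add zero inv simp: End_ring_apply D M.a_ac)
    show "Group.monoid ?S"
      by (rule monoidI)
        (auto intro!: End_ring_eqI mult one simp: End_ring_apply D)
  qed (auto intro!: End_ring_eqI mult add simp: End_ring_apply D)
qed

text \<open>The inverse in the ring is a two-sided inverse map on the carrier. This carries
  information about units of the endomorphism ring over to invariance under automorphisms.\<close>

lemma End_ring_Units_auto:
  assumes "f \<in> Units (End_ring R M)"
  shows "f \<in> rmod_auto R M"
proof -
  obtain g where fg: "f \<in> carrier (End_ring R M)" "g \<in> carrier (End_ring R M)"
    "g \<otimes>\<^bsub>End_ring R M\<^esub> f = \<one>\<^bsub>End_ring R M\<^esub>" "f \<otimes>\<^bsub>End_ring R M\<^esub> g = \<one>\<^bsub>End_ring R M\<^esub>"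
    using assms by (auto simp: Units_def)
  note D = rmod_homD[OF End_ring_memD(1)]
  have "bij_betw f (carrier M) (carrier M)"
  proof (rule bij_betw_byWitness[where f' = g])
    show "\<forall>x\<in>carrier M. g (f x) = x" "\<forall>x\<in>carrier M. f (g x) = x"
      using fg(3,4) End_ring_apply(1,3) by metis+
  qed (use fg D(1) in auto)
  then show ?thesis
    using fg(1) End_ring_memD(1) by (simp add: rmod_iso_def)
qed

text \<open>An idempotent \<open>e\<close> splits the module into its image and its kernel, through
  \<open>x = e x + (x - e x)\<close>. If the image vanishes then \<open>e\<close> is zero; if the
  kernel vanishes then every \<open>x - e x\<close> does, and \<open>e\<close> is the
  identity.\<close>

lemma indecomposable_trivial_idempotents:
  assumes "indecomposable_module R M"
    and e: "e \<in> carrier (End_ring R M)" and idem: "e \<otimes>\<^bsub>End_ring R M\<^esub> e = e"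
  shows "e = \<zero>\<^bsub>End_ring R M\<^esub> \<or> e = \<one>\<^bsub>End_ring R M\<^esub>"
proof -
  interpret S: ring "End_ring R M" by (rule End_ring_ring)
  interpret e: right_module_hom R M M e
    by unfold_locales (rule End_ring_memD(1)[OF e])
  \<comment> \<open>The kernel is written as the preimage of the zero submodule, so that
    \<open>submodule_vimage\<close> applies to it.\<close>
  let ?A = "e ` carrier M" and ?B = "{x \<in> carrier M. e x \<in> {\<zero>\<^bsub>M\<^esub>}}"
  have ee: "e (e x) = e x" if "x \<in> carrier M" for x
    using idem End_ring_apply(1)[OF that] by metis
  have compl: "x \<ominus>\<^bsub>M\<^esub> e x \<in> ?B" if "x \<in> carrier M" for x
    using that e.hom_closed by (simp add: e.hom_minus ee minus_eq_zero_iff)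
  have "?A <+>\<^bsub>M\<^esub> ?B = carrier M"
  proof
    show "?A <+>\<^bsub>M\<^esub> ?B \<subseteq> carrier M"
      using e.hom_closed by (auto simp: set_add_def')
    show "carrier M \<subseteq> ?A <+>\<^bsub>M\<^esub> ?B"
    proof
      fix x assume x: "x \<in> carrier M"
      then have "x = e x \<oplus>\<^bsub>M\<^esub> (x \<ominus>\<^bsub>M\<^esub> e x)"
        using e.hom_closed minus_add_cancel M.a_comm[of "e x" "x \<ominus>\<^bsub>M\<^esub> e x"] by simp
      then show "x \<in> ?A <+>\<^bsub>M\<^esub> ?B"
        unfolding set_add_def' using x compl by blast
    qed
  qed
  moreover have "?A \<inter> ?B = {\<zero>\<^bsub>M\<^esub>}"
    using ee e.hom_zero by (auto simp: image_iff) (metis M.zero_closed)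
  ultimately have "?A = {\<zero>\<^bsub>M\<^esub>} \<or> ?B = {\<zero>\<^bsub>M\<^esub>}"
    by (rule indecomposable_moduleD[OF assms(1) e.submodule_image
          e.submodule_vimage[OF zero_submodule]])
  then show ?thesis
  proof
    assume "?A = {\<zero>\<^bsub>M\<^esub>}"
    then have "e = \<zero>\<^bsub>End_ring R M\<^esub>"
      using e by (intro End_ring_eqI) (auto simp: End_ring_apply)
    then show ?thesis ..
  next
    assume B: "?B = {\<zero>\<^bsub>M\<^esub>}"
    have "e = \<one>\<^bsub>End_ring R M\<^esub>"
    proof (rule End_ring_eqI)
      fix x assume x: "x \<in> carrier M"
      then have "x \<ominus>\<^bsub>M\<^esub> e x = \<zero>\<^bsub>M\<^esub>" using compl B by blast
      then show "e x = \<one>\<^bsub>End_ring R M\<^esub> x"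
        using x e.hom_closed minus_eq_zero_iff by (simp add: End_ring_apply)
    qed (use e in auto)
    then show ?thesis ..
  qed
qed

end

section \<open>The Jacobson radical\<close>

context ring
begin

text \<open>Translates submodules of the regular right module into ring terms. Closure under
  negatives can be left out of the list because \<open>\<ominus> x\<close> is \<open>x\<close> times
  \<open>\<ominus> \<one>\<close>.\<close>

lemma right_ideal_iff:
  "right_ideal I R \<longleftrightarrow> I \<subseteq> carrier R \<and> \<zero> \<in> I \<and> (\<forall>x\<in>I. \<forall>y\<in>I. x \<oplus> y \<in> I) \<and>
    (\<forall>x\<in>I. \<forall>r\<in>carrier R. x \<otimes> r \<in> I)"
proof -
  have "abelian_group (regular_right_module R)"
  proof (rule abelian_groupI)
    fix x assume "x \<in> carrier (regular_right_module R)"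
    then show "\<exists>y\<in>carrier (regular_right_module R).
        y \<oplus>\<^bsub>regular_right_module R\<^esub> x = \<zero>\<^bsub>regular_right_module R\<^esub>"
      using l_neg by (auto simp: regular_right_module_def)
  qed (simp_all add: regular_right_module_def a_ac)
  then interpret S: right_module R "regular_right_module R"
    by (intro right_module.intro right_module_axioms.intro)
      (simp_all add: ring_axioms, simp_all add: regular_right_module_def l_distr r_distr m_assoc)
  have minv: "\<ominus>\<^bsub>regular_right_module R\<^esub> x = \<ominus> x" for x
    by (simp add: a_inv_def m_inv_def regular_right_module_def)
  show ?thesis
  proof
    assume I: "right_ideal I R"
    show "I \<subseteq> carrier R \<and> \<zero> \<in> I \<and> (\<forall>x\<in>I. \<forall>y\<in>I. x \<oplus> y \<in> I) \<and>
        (\<forall>x\<in>I. \<forall>r\<in>carrier R. x \<otimes> r \<in> I)"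
      using S.submoduleD[OF I] by (auto simp: regular_right_module_def)
  next
    assume I: "I \<subseteq> carrier R \<and> \<zero> \<in> I \<and> (\<forall>x\<in>I. \<forall>y\<in>I. x \<oplus> y \<in> I) \<and>
        (\<forall>x\<in>I. \<forall>r\<in>carrier R. x \<otimes> r \<in> I)"
    have "\<ominus> x \<in> I" if "x \<in> I" for x
    proof -
      have "x \<otimes> (\<ominus> \<one>) \<in> I" "x \<in> carrier R" using I that by auto
      then show ?thesis by (simp add: r_minus)
    qed
    then show "right_ideal I R"
      using I by (intro S.submoduleI) (auto simp: minv, auto simp: regular_right_module_def)
  qed
qed

lemma right_idealD:
  assumes "right_ideal I R"
  shows "I \<subseteq> carrier R" "\<zero> \<in> I"
    and "\<And>x y. \<lbrakk>x \<in> I; y \<in> I\<rbrakk> \<Longrightarrow> x \<oplus> y \<in> I"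
    and "\<And>x r. \<lbrakk>x \<in> I; r \<in> carrier R\<rbrakk> \<Longrightarrow> x \<otimes> r \<in> I"
  using right_ideal_iff[THEN iffD1, OF assms] by simp_all

lemma right_ideal_one_imp_carrier:
  assumes "right_ideal I R" "\<one> \<in> I"
  shows "I = carrier R"
proof
  show "I \<subseteq> carrier R" using assms(1) by (rule right_idealD)
  show "carrier R \<subseteq> I"
    using right_idealD(4)[OF assms] l_one by (metis subsetI)
qed

lemma principal_right_ideal:
  assumes "a \<in> carrier R"
  shows "right_ideal {a \<otimes> r | r. r \<in> carrier R} R"
  unfolding right_ideal_iff
proof (intro conjI ballI)
  show "\<zero> \<in> {a \<otimes> r | r. r \<in> carrier R}"
    using assms r_null zero_closed by (metis (mono_tags, lifting) mem_Collect_eq)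
next
  fix x y assume "x \<in> {a \<otimes> r | r. r \<in> carrier R}" "y \<in> {a \<otimes> r | r. r \<in> carrier R}"
  then obtain r s where "r \<in> carrier R" "s \<in> carrier R" "x = a \<otimes> r" "y = a \<otimes> s" by blast
  then have "x \<oplus> y = a \<otimes> (r \<oplus> s)" "r \<oplus> s \<in> carrier R"
    using assms by (simp_all add: r_distr)
  then show "x \<oplus> y \<in> {a \<otimes> r | r. r \<in> carrier R}"
    by (intro CollectI exI[of _ "r \<oplus> s"] conjI)
next
  fix x s assume "x \<in> {a \<otimes> r | r. r \<in> carrier R}" and s: "s \<in> carrier R"
  then obtain r where "r \<in> carrier R" "x = a \<otimes> r" by blast
  then have "x \<otimes> s = a \<otimes> (r \<otimes> s)" "r \<otimes> s \<in> carrier R"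
    using assms s by (simp_all add: m_assoc)
  then show "x \<otimes> s \<in> {a \<otimes> r | r. r \<in> carrier R}"
    by (intro CollectI exI[of _ "r \<otimes> s"] conjI)
qed (use assms in auto)

section \<open>Maximal right ideals and their intersection\<close>

lemma maximal_right_idealD:
  assumes "maximal_right_ideal I R"
  shows "right_ideal I R" "\<one> \<notin> I"
proof -
  note max = assms[unfolded maximal_right_ideal_def]
  show I: "right_ideal I R" using max by (rule conjunct1)
  have "I \<noteq> carrier R" using max[THEN conjunct2] by (rule conjunct1)
  then show "\<one> \<notin> I" using right_ideal_one_imp_carrier[OF I] by metis
qed

text \<open>Zorn's lemma, applied to the proper right ideals above \<open>I\<close>.\<close>

lemma exists_maximal_right_ideal:
  assumes I: "right_ideal I R" "I \<noteq> carrier R"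
  obtains K where "maximal_right_ideal K R" "I \<subseteq> K"
proof -
  \<comment> \<open>Properness is expressed as omitting \<open>\<one>\<close>, a condition that
    visibly survives unions of chains.\<close>
  let ?P = "{K. right_ideal K R \<and> \<one> \<notin> K \<and> I \<subseteq> K}"
  have "\<exists>K\<in>?P. \<forall>L\<in>?P. K \<subseteq> L \<longrightarrow> L = K"
  proof (rule subset_Zorn_nonempty)
    show "?P \<noteq> {}" using I right_ideal_one_imp_carrier by blast
  next
    fix C assume "C \<noteq> {}" and chain: "subset.chain ?P C"
    then have C: "\<And>K. K \<in> C \<Longrightarrow> right_ideal K R \<and> \<one> \<notin> K \<and> I \<subseteq> K"
      by (auto simp: subset_chain_def)
    have "right_ideal (\<Union>C) R"
      unfolding right_ideal_iff
    proof (intro conjI ballI)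
      show "\<Union>C \<subseteq> carrier R" "\<zero> \<in> \<Union>C"
        using C \<open>C \<noteq> {}\<close> unfolding right_ideal_iff by blast+
      show "x \<otimes> r \<in> \<Union>C" if "x \<in> \<Union>C" "r \<in> carrier R" for x r
        using C that unfolding right_ideal_iff by blast
      fix x y assume "x \<in> \<Union>C" "y \<in> \<Union>C"
      then obtain K L where KL: "K \<in> C" "L \<in> C" "x \<in> K" "y \<in> L" by blast
      then have "K \<subseteq> L \<or> L \<subseteq> K"
        using chain unfolding subset_chain_def by blast
      then obtain N where "N \<in> C" "x \<in> N" "y \<in> N" using KL by blast
      then show "x \<oplus> y \<in> \<Union>C"
        using C unfolding right_ideal_iff by blast
    qed
    then show "\<Union>C \<in> ?P" using C \<open>C \<noteq> {}\<close> by blast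
  qed
  then obtain K where KP: "K \<in> ?P" and max: "\<forall>L\<in>?P. K \<subseteq> L \<longrightarrow> L = K" ..
  then have K: "right_ideal K R" "\<one> \<notin> K" "I \<subseteq> K" by auto
  have "maximal_right_ideal K R"
    unfolding maximal_right_ideal_def
  proof (intro conjI allI impI)
    show "K \<noteq> carrier R" using K(2) by auto
    fix L assume L: "right_ideal L R \<and> K \<subseteq> L"
    show "L = K \<or> L = carrier R"
    proof (cases "\<one> \<in> L")
      case True
      then show ?thesis using L right_ideal_one_imp_carrier by simp
    next
      case False
      then have "L \<in> ?P" using L K(3) by auto
      then show ?thesis using max L by simp
    qed
  qed (rule K(1))
  then show ?thesis using K(3) by (rule that)
qed

lemma right_ideal_jacobson_radical: "right_ideal (jacobson_radical R) R"
proof -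
  note D = right_idealD[OF maximal_right_idealD(1)]
  show ?thesis
    unfolding right_ideal_iff jacobson_radical_def by (auto intro: D)
qed

text \<open>If the right ideal generated by \<open>\<one> \<ominus> x\<close> were proper, a maximal
  right ideal above it would contain \<open>x\<close> as well, and hence
  \<open>\<one>\<close>.\<close>

lemma one_minus_jacobson_radical_right_inverse:
  assumes "x \<in> jacobson_radical R"
  obtains y where "y \<in> carrier R" "(\<one> \<ominus> x) \<otimes> y = \<one>"
proof -
  have x: "x \<in> carrier R" using assms by (simp add: jacobson_radical_def)
  let ?I = "{(\<one> \<ominus> x) \<otimes> r | r. r \<in> carrier R}"
  have I: "right_ideal ?I R" using principal_right_ideal x by simp
  have "?I = carrier R"
  proof (rule ccontr)
    assume "?I \<noteq> carrier R"
    with I obtain K where K: "maximal_right_ideal K R" "?I \<subseteq> K"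
      by (rule exists_maximal_right_ideal)
    then have xK: "x \<in> K" using assms by (simp add: jacobson_radical_def)
    have "\<one> \<ominus> x \<in> ?I"
      using x by (intro CollectI exI[of _ "\<one>"] conjI) simp_all
    then have "\<one> \<ominus> x \<in> K" using K(2) by (rule rev_subsetD)
    then have "(\<one> \<ominus> x) \<oplus> x \<in> K"
      using xK by (rule right_idealD(3)[OF maximal_right_idealD(1)[OF K(1)]])
    moreover have "(\<one> \<ominus> x) \<oplus> x = \<one>"
      using x by (simp add: a_minus_def a_assoc l_neg)
    ultimately have "\<one> \<in> K" by simp
    then show False
      using maximal_right_idealD(2)[OF K(1)] by simp
  qed
  then have "\<one> \<in> ?I" by simp
  then obtain y where "y \<in> carrier R" "(\<one> \<ominus> x) \<otimes> y = \<one>"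
    unfolding mem_Collect_eq by metis
  then show ?thesis by (rule that)
qed

text \<open>From \<open>a \<otimes> c = \<one>\<close> the product \<open>c \<otimes> a\<close> is
  idempotent, so triviality of idempotents turns a one-sided inverse into a two-sided one.\<close>

lemma trivial_idempotents_right_inverse_Units:
  assumes triv: "\<And>e. \<lbrakk>e \<in> carrier R; e \<otimes> e = e\<rbrakk> \<Longrightarrow> e = \<zero> \<or> e = \<one>"
    and a: "a \<in> carrier R" and c: "c \<in> carrier R" and ac: "a \<otimes> c = \<one>"
  shows "a \<in> Units R"
proof -
  have "(c \<otimes> a) \<otimes> (c \<otimes> a) = c \<otimes> (a \<otimes> c) \<otimes> a"
    using a c by (simp add: m_assoc)
  then have "c \<otimes> a = \<zero> \<or> c \<otimes> a = \<one>"
    using triv a c ac by simp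
  \<comment> \<open>The zero ring is not excluded. If \<open>c \<otimes> a\<close> is zero, then so
    is \<open>a = a \<otimes> c \<otimes> a\<close>, the ring collapses, and
    \<open>c \<otimes> a = \<one>\<close> holds all the same.\<close>
  moreover have "\<zero> = \<one>" if "c \<otimes> a = \<zero>"
  proof -
    have "a \<otimes> c \<otimes> a = \<zero>" using a c that by (simp add: m_assoc)
    then have "a = \<zero>" using a ac by simp
    then show ?thesis using ac c by simp
  qed
  ultimately have "c \<otimes> a = \<one>" by auto
  then show ?thesis using a c ac by (auto simp: Units_def)
qed

text \<open>Regularity of the quotient is pulled back to representatives. The product in
  \<open>R Quot I\<close> is a union of cosets of products of representatives, so the argument works
  with a right ideal and never asks whether multiplication of cosets is well defined.\<close>

lemma von_neumann_regular_Quot: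
  assumes I: "right_ideal I R" and reg: "von_neumann_regular (R Quot I)"
    and a: "a \<in> carrier R"
  obtains b where "b \<in> carrier R" "a \<otimes> b \<otimes> a \<ominus> a \<in> I"
proof -
  have coset: "I +> x = {h \<oplus> x | h. h \<in> I}" for x
    by (auto simp: a_r_coset_def')
  have self: "x \<in> I +> x" if "x \<in> carrier R" for x
    using that right_idealD(2)[OF I] l_zero[OF that, symmetric] unfolding coset by blast
  have "I +> a \<in> carrier (R Quot I)"
    using a by (auto simp: FactRing_def A_RCOSETS_def')
  then obtain B where B: "B \<in> carrier (R Quot I)"
    and eq: "(I +> a) \<otimes>\<^bsub>R Quot I\<^esub> B \<otimes>\<^bsub>R Quot I\<^esub> (I +> a) = I +> a"
    using reg unfolding von_neumann_regular_def by blast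
  then obtain b where b: "b \<in> carrier R" "B = I +> b"
    by (auto simp: FactRing_def A_RCOSETS_def')
  \<comment> \<open>A product of representatives belongs to its own coset, which is one of the
    cosets in the union defining the product.\<close>
  have mult: "x \<otimes> y \<in> A \<otimes>\<^bsub>R Quot I\<^esub> C"
    if "x \<in> A" "y \<in> C" "x \<in> carrier R" "y \<in> carrier R" for x y A C
    using that self[of "x \<otimes> y"] by (auto simp: FactRing_def rcoset_mult_def)
  have "a \<otimes> b \<otimes> a \<in> (I +> a) \<otimes>\<^bsub>R Quot I\<^esub> B \<otimes>\<^bsub>R Quot I\<^esub> (I +> a)"
    unfolding b(2) using a b(1) by (intro mult self) simp_all
  then have "a \<otimes> b \<otimes> a \<in> I +> a" by (simp only: eq)
  then obtain h where h: "h \<in> I" "a \<otimes> b \<otimes> a = h \<oplus> a"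
    unfolding coset by blast
  then have "h \<in> carrier R" using right_idealD(1)[OF I] by blast
  then have "a \<otimes> b \<otimes> a \<ominus> a \<in> I"
    using h a by (simp add: a_minus_def a_assoc r_neg)
  then show ?thesis using that b(1) by blast
qed

text \<open>Regularity supplies \<open>b\<close> for which \<open>a \<otimes> b\<close> is
  idempotent modulo the radical, and its lift \<open>e\<close> is zero or one. If \<open>e\<close>
  is zero, \<open>a\<close> lies in the radical and \<open>\<one> \<ominus> a\<close> is right
  invertible; if \<open>e\<close> is one, \<open>a \<otimes> b\<close> is right invertible, and so
  is \<open>a\<close>. Right invertible elements are units here.\<close>

lemma trivial_idempotents_imp_local:
  assumes triv: "\<And>e. \<lbrakk>e \<in> carrier R; e \<otimes> e = e\<rbrakk> \<Longrightarrow> e = \<zero> \<or> e = \<one>"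
    and reg: "von_neumann_regular (R Quot jacobson_radical R)"
    and lift: "idempotents_lift_modulo R (jacobson_radical R)"
    and a: "a \<in> carrier R"
  shows "a \<in> Units R \<or> \<one> \<ominus> a \<in> Units R"
proof -
  let ?J = "jacobson_radical R"
  have Jr: "x \<otimes> r \<in> ?J" if "x \<in> ?J" "r \<in> carrier R" for x r
    using right_ideal_jacobson_radical that by (rule right_idealD)
  have Jadd: "x \<oplus> y \<in> ?J" if "x \<in> ?J" "y \<in> ?J" for x y
    using right_ideal_jacobson_radical that by (rule right_idealD)
  have Jc: "x \<in> carrier R" if "x \<in> ?J" for x
    using that by (simp add: jacobson_radical_def)
  have Jneg: "\<ominus> x \<in> ?J" if "x \<in> ?J" for x
    using Jr[OF that, of "\<ominus> \<one>"] Jc[OF that] by (simp add: r_minus)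
  obtain b where b: "b \<in> carrier R" and aba: "a \<otimes> b \<otimes> a \<ominus> a \<in> ?J"
    using von_neumann_regular_Quot[OF right_ideal_jacobson_radical reg a] by blast
  have ab: "a \<otimes> b \<in> carrier R" using a b by simp
  \<comment> \<open>The factor \<open>b\<close> stands on the right, so membership in the radical
    needs only that it is a right ideal. This is why \<open>a \<otimes> b\<close> is used and not
    \<open>b \<otimes> a\<close>.\<close>
  have "(a \<otimes> b) \<otimes> (a \<otimes> b) \<ominus> a \<otimes> b = (a \<otimes> b \<otimes> a \<ominus> a) \<otimes> b"
    using a b by (simp add: a_minus_def l_distr l_minus m_assoc)
  then have "(a \<otimes> b) \<otimes> (a \<otimes> b) \<ominus> a \<otimes> b \<in> ?J"
    using Jr[OF aba b] by simp
  then obtain e where e: "e \<in> carrier R" "e \<otimes> e = e" "e \<ominus> a \<otimes> b \<in> ?J"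
    using lift ab unfolding idempotents_lift_modulo_def by blast
  then consider "e = \<zero>" | "e = \<one>" using triv by blast
  then show ?thesis
  proof cases
    case 1
    then have "\<ominus> (a \<otimes> b) \<in> ?J" using e(3) ab by (simp add: a_minus_def)
    then have "a \<otimes> b \<otimes> a \<in> ?J"
      using Jneg Jr[OF _ a] minus_minus[OF ab] by metis
    \<comment> \<open>Both \<open>a \<otimes> b \<otimes> a\<close> and its difference from
      \<open>a\<close> lie in the radical, so \<open>a\<close> does too.\<close>
    then have "a \<otimes> b \<otimes> a \<oplus> \<ominus> (a \<otimes> b \<otimes> a \<ominus> a) \<in> ?J"
      using Jneg[OF aba] Jadd by blast
    moreover have "a \<otimes> b \<otimes> a \<oplus> \<ominus> (a \<otimes> b \<otimes> a \<ominus> a) = a"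
      using a ab by (simp add: a_minus_def minus_add r_neg2)
    ultimately have "a \<in> ?J" by simp
    then obtain y where "y \<in> carrier R" "(\<one> \<ominus> a) \<otimes> y = \<one>"
      using one_minus_jacobson_radical_right_inverse by blast
    then have "\<one> \<ominus> a \<in> Units R"
      using trivial_idempotents_right_inverse_Units[OF triv] a by blast
    then show ?thesis ..
  next
    case 2
    then obtain y where y: "y \<in> carrier R" "(\<one> \<ominus> (\<one> \<ominus> a \<otimes> b)) \<otimes> y = \<one>"
      using one_minus_jacobson_radical_right_inverse e(3) by blast
    moreover have "\<one> \<ominus> (\<one> \<ominus> a \<otimes> b) = a \<otimes> b"
      using ab by (simp add: a_minus_def minus_add r_neg2)
    \<comment> \<open>The element of the radical is \<open>\<one> \<ominus> a \<otimes> b\<close>,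
      so the right inverse \<open>y\<close> obtained above belongs to
      \<open>a \<otimes> b\<close>.\<close>
    ultimately have "a \<otimes> (b \<otimes> y) = \<one>" using a b by (simp add: m_assoc)
    then have "a \<in> Units R"
      using trivial_idempotents_right_inverse_Units[OF triv a, of "b \<otimes> y"] b y by simp
    then show ?thesis ..
  qed
qed

end

section \<open>Envelopes\<close>

text \<open>The projection onto \<open>A\<close> along \<open>B\<close> fixes the image of
  \<open>u\<close>, so the envelope property makes it an automorphism. It also kills
  \<open>B\<close>, which must therefore be zero.\<close>

lemma envelope_in_summand_imp_complement_zero:
  assumes X: "right_module R X" and env: "is_envelope R \<X> M X u"
    and A: "submodule A R X" and B: "submodule B R X"
    and sum: "A <+>\<^bsub>X\<^esub> B = carrier X" and int: "A \<inter> B = {\<zero>\<^bsub>X\<^esub>}"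
    and u: "\<And>m. m \<in> carrier M \<Longrightarrow> u m \<in> A"
  shows "B = {\<zero>\<^bsub>X\<^esub>}"
proof -
  interpret X: right_module R X by (rule X)
  obtain p where p: "p \<in> rmod_endo R X"
    and pAB: "(\<forall>x\<in>carrier X. p x \<in> A \<and> x \<ominus>\<^bsub>X\<^esub> p x \<in> B) \<and>
      (\<forall>x\<in>A. p x = x) \<and> (\<forall>x\<in>B. p x = \<zero>\<^bsub>X\<^esub>)"
    using X.direct_sum_projection[OF A B sum int] ..
  have pA: "p x = x" if "x \<in> A" for x using pAB that by simp
  have pB: "p x = \<zero>\<^bsub>X\<^esub>" if "x \<in> B" for x using pAB that by simp
  have "p \<in> rmod_auto R X"
    using env p u pA unfolding is_envelope_def by simp
  then have inj: "inj_on p (carrier X)"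
    by (simp add: rmod_iso_def bij_betw_def)
  have zB: "\<zero>\<^bsub>X\<^esub> \<in> B" using B by (rule X.submoduleD)
  have "b = \<zero>\<^bsub>X\<^esub>" if b: "b \<in> B" for b
  proof (rule inj_onD[OF inj])
    show "p b = p \<zero>\<^bsub>X\<^esub>" using pB[OF b] pB[OF zB] by simp
    show "b \<in> carrier X" using X.submoduleD(1)[OF B] b by (rule subsetD)
  qed simp
  then have "B \<subseteq> {\<zero>\<^bsub>X\<^esub>}" by (intro subsetI singleton_iff[THEN iffD2])
  moreover have "{\<zero>\<^bsub>X\<^esub>} \<subseteq> B" using zB by simp
  ultimately show ?thesis by (rule equalityI)
qed

text \<open>A projection of \<open>X\<close> induces an endomorphism \<open>f\<close> of
  \<open>M\<close>, and \<open>m = f m + (m - f m)\<close> decomposes \<open>M\<close> into the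
  preimages of \<open>A\<close> and \<open>B\<close>. One preimage is zero, so \<open>u\<close> maps
  \<open>M\<close> into the opposite summand.\<close>

lemma endomorphism_invariant_imp_indecomposable:
  assumes M: "right_module R M" and X: "right_module R X"
    and indec: "indecomposable_module R M" and inj: "inj_on u (carrier M)"
    and inv: "endomorphism_invariant R \<X> M X u"
  shows "indecomposable_module R X"
proof -
  have env: "is_envelope R \<X> M X u"
    using inv by (simp add: endomorphism_invariant_def)
  interpret u: right_module_hom R M X u
    using M X env by (simp add: right_module_hom_def right_module_hom_axioms_def is_envelope_def)
  have u0: "m = \<zero>\<^bsub>M\<^esub>" if "m \<in> carrier M" "u m = \<zero>\<^bsub>X\<^esub>" for m
    using inj_onD[OF inj, of m "\<zero>\<^bsub>M\<^esub>"] that u.hom_zero by simp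
  have "carrier X \<noteq> {\<zero>\<^bsub>X\<^esub>}"
  proof
    assume "carrier X = {\<zero>\<^bsub>X\<^esub>}"
    then have "carrier M = {\<zero>\<^bsub>M\<^esub>}" using u0 u.hom_closed by auto
    then show False using indec by (simp add: indecomposable_module_def)
  qed
  moreover have "A = {\<zero>\<^bsub>X\<^esub>} \<or> B = {\<zero>\<^bsub>X\<^esub>}"
    if A: "submodule A R X" and B: "submodule B R X"
      and sum: "A <+>\<^bsub>X\<^esub> B = carrier X" and int: "A \<inter> B = {\<zero>\<^bsub>X\<^esub>}" for A B
  proof -
    obtain p where p: "p \<in> rmod_endo R X"
      and pAB: "(\<forall>x\<in>carrier X. p x \<in> A \<and> x \<ominus>\<^bsub>X\<^esub> p x \<in> B) \<and>
        (\<forall>x\<in>A. p x = x) \<and> (\<forall>x\<in>B. p x = \<zero>\<^bsub>X\<^esub>)"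
      using u.N.direct_sum_projection[OF A B sum int] ..
    obtain f where f: "f \<in> rmod_endo R M" "\<And>m. m \<in> carrier M \<Longrightarrow> p (u m) = u (f m)"
      using inv p unfolding endomorphism_invariant_def by blast
    note fc = rmod_homD(1)[OF f(1)]
    let ?A = "{m \<in> carrier M. u m \<in> A}" and ?B = "{m \<in> carrier M. u m \<in> B}"
    have fA: "f m \<in> ?A" if "m \<in> carrier M" for m
      using that pAB u.hom_closed[OF that] fc by (simp flip: f(2))
    have fB: "m \<ominus>\<^bsub>M\<^esub> f m \<in> ?B" if "m \<in> carrier M" for m
      using that pAB u.hom_closed[OF that] fc by (simp add: u.hom_minus flip: f(2))
    have "?A <+>\<^bsub>M\<^esub> ?B = carrier M"
    proof
      show "?A <+>\<^bsub>M\<^esub> ?B \<subseteq> carrier M" by (auto simp: set_add_def')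
      show "carrier M \<subseteq> ?A <+>\<^bsub>M\<^esub> ?B"
      proof
        fix m assume m: "m \<in> carrier M"
        then have "m = f m \<oplus>\<^bsub>M\<^esub> (m \<ominus>\<^bsub>M\<^esub> f m)"
          using fc u.M.minus_add_cancel u.M.M.a_comm[of "f m" "m \<ominus>\<^bsub>M\<^esub> f m"] by simp
        then show "m \<in> ?A <+>\<^bsub>M\<^esub> ?B"
          unfolding set_add_def' using fA[OF m] fB[OF m] by blast
      qed
    qed
    moreover have "?A \<inter> ?B = {\<zero>\<^bsub>M\<^esub>}"
    \<comment> \<open>Here injectivity of \<open>u\<close> enters, through \<open>u0\<close>: an
      element mapped into both \<open>A\<close> and \<open>B\<close> is mapped to zero.\<close>
    proof (intro equalityI subsetI)
      fix m assume "m \<in> ?A \<inter> ?B"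
      then have m: "m \<in> carrier M" and um: "u m \<in> A \<inter> B" by simp_all
      have "u m = \<zero>\<^bsub>X\<^esub>" using um unfolding int by (rule singletonD)
      then show "m \<in> {\<zero>\<^bsub>M\<^esub>}" using u0[OF m] by simp
    next
      fix m assume "m \<in> {\<zero>\<^bsub>M\<^esub>}"
      then show "m \<in> ?A \<inter> ?B"
        using u.N.submoduleD(2)[OF A] u.N.submoduleD(2)[OF B] u.hom_zero by simp
    qed
    ultimately have "?A = {\<zero>\<^bsub>M\<^esub>} \<or> ?B = {\<zero>\<^bsub>M\<^esub>}"
      by (rule indecomposable_moduleD[OF indec u.submodule_vimage[OF A] u.submodule_vimage[OF B]])
    then show ?thesis
    proof
      \<comment> \<open>With zero preimage of \<open>A\<close>, the component \<open>f m\<close>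
        vanishes for every \<open>m\<close>, so \<open>m\<close> equals its component in the
        preimage of \<open>B\<close>.\<close>
      assume A0: "?A = {\<zero>\<^bsub>M\<^esub>}"
      have "u m \<in> B" if m: "m \<in> carrier M" for m
      proof -
        have "f m = \<zero>\<^bsub>M\<^esub>" using fA[OF m] A0 by blast
        then have "m \<ominus>\<^bsub>M\<^esub> f m = m"
          using m by (simp add: a_minus_def)
        then show ?thesis using fB[OF m] by simp
      qed
      moreover have "B <+>\<^bsub>X\<^esub> A = carrier X"
        using sum u.N.submoduleD(1)[OF A] u.N.submoduleD(1)[OF B]
        by (simp add: u.N.M.set_add_commute)
      ultimately have "A = {\<zero>\<^bsub>X\<^esub>}"
        using envelope_in_summand_imp_complement_zero[OF X env B A] int by blast
      then show ?thesis ..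
    next
      assume B0: "?B = {\<zero>\<^bsub>M\<^esub>}"
      have "u m \<in> A" if m: "m \<in> carrier M" for m
      proof -
        have "m \<ominus>\<^bsub>M\<^esub> f m = \<zero>\<^bsub>M\<^esub>" using fB[OF m] B0 by blast
        then have "m = f m" using u.M.minus_eq_zero_iff m fc by simp
        then show ?thesis using fA[OF m] by simp
      qed
      then have "B = {\<zero>\<^bsub>X\<^esub>}"
        using envelope_in_summand_imp_complement_zero[OF X env A B sum int] by blast
      then show ?thesis ..
    qed
  qed
  ultimately show ?thesis
    unfolding indecomposable_module_def by blast
qed

text \<open>For each \<open>g\<close>, either \<open>g\<close> or one minus \<open>g\<close> is a
  unit of the endomorphism ring, hence an automorphism of \<open>X\<close>. In the second case it
  induces some \<open>k\<close> on \<open>M\<close>, and one minus \<open>k\<close> is then induced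
  by \<open>g\<close>.\<close>

lemma indecomposable_imp_endomorphism_invariant:
  assumes M: "right_module R M" and X: "right_module R X"
    and inv: "automorphism_invariant R \<X> M X u"
    and indec: "indecomposable_module R X"
    and reg: "von_neumann_regular (End_ring R X Quot jacobson_radical (End_ring R X))"
    and lift: "idempotents_lift_modulo (End_ring R X) (jacobson_radical (End_ring R X))"
  shows "endomorphism_invariant R \<X> M X u"
proof -
  have env: "is_envelope R \<X> M X u"
    using inv by (simp add: automorphism_invariant_def)
  interpret u: right_module_hom R M X u
    using M X env by (simp add: right_module_hom_def right_module_hom_axioms_def is_envelope_def)
  interpret S: ring "End_ring R X" by (rule u.N.End_ring_ring)
  have auto_inv: "\<exists>f\<in>rmod_endo R M. \<forall>m\<in>carrier M. h (u m) = u (f m)" if "h \<in> Units (End_ring R X)" for h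
    using inv u.N.End_ring_Units_auto[OF that] unfolding automorphism_invariant_def by blast
  have "\<exists>f\<in>rmod_endo R M. \<forall>m\<in>carrier M. g (u m) = u (f m)" if g: "g \<in> rmod_endo R X" for g
  proof -
    \<comment> \<open>Ring elements are extensional, so \<open>g\<close> is first normalised; on the
      image of \<open>u\<close> this changes nothing.\<close>
    let ?g = "restrict g (carrier X)" and ?S = "End_ring R X"
    have gS: "?g \<in> carrier ?S" by (rule u.N.End_ring_memI[OF g])
    have "?g \<in> Units ?S \<or> \<one>\<^bsub>?S\<^esub> \<ominus>\<^bsub>?S\<^esub> ?g \<in> Units ?S"
      using u.N.indecomposable_trivial_idempotents[OF indec] reg lift gS
      by (intro S.trivial_idempotents_imp_local) auto
    then show ?thesis
    proof
      assume "?g \<in> Units ?S"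
      then show ?thesis using auto_inv[of ?g] by (simp add: u.hom_closed)
    next
      let ?h = "\<one>\<^bsub>?S\<^esub> \<ominus>\<^bsub>?S\<^esub> ?g"
      assume "?h \<in> Units ?S"
      then obtain k where k: "k \<in> rmod_endo R M" "\<And>m. m \<in> carrier M \<Longrightarrow> ?h (u m) = u (k m)"
        using auto_inv by blast
      have hS: "?h \<in> carrier ?S" using gS by simp
      have "?h \<oplus>\<^bsub>?S\<^esub> ?g = \<one>\<^bsub>?S\<^esub>"
        using gS by (simp add: a_minus_def S.a_assoc S.l_neg)
      then have hg: "?h x \<oplus>\<^bsub>X\<^esub> g x = x" if "x \<in> carrier X" for x
        using u.N.End_ring_apply(2,3)[OF that] that by (metis restrict_apply')
      have kc: "k m \<in> carrier M" if "m \<in> carrier M" for m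
        using rmod_homD(1)[OF k(1) that] .
      have kS: "restrict k (carrier M) \<in> carrier (End_ring R M)"
        by (rule u.M.End_ring_memI[OF k(1)])
      interpret E: ring "End_ring R M" by (rule u.M.End_ring_ring)
      \<comment> \<open>One minus \<open>k\<close> is formed inside the endomorphism ring of
        \<open>M\<close>, which yields its linearity without further computation.\<close>
      let ?f = "\<one>\<^bsub>End_ring R M\<^esub> \<ominus>\<^bsub>End_ring R M\<^esub> restrict k (carrier M)"
      have fS: "?f \<in> carrier (End_ring R M)" using kS by simp
      have "restrict k (carrier M) \<oplus>\<^bsub>End_ring R M\<^esub> ?f = \<one>\<^bsub>End_ring R M\<^esub>"
        using kS E.a_lcomm[OF kS E.one_closed E.a_inv_closed[OF kS]]
        by (simp add: a_minus_def E.r_neg)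
      then have kf: "k m \<oplus>\<^bsub>M\<^esub> ?f m = m" if "m \<in> carrier M" for m
        using u.M.End_ring_apply(2,3)[OF that] that by (metis restrict_apply')
      have f: "?f \<in> rmod_endo R M" by (rule u.M.End_ring_memD(1)[OF fS])
      have "g (u m) = u (?f m)" if m: "m \<in> carrier M" for m
      proof -
        have fm: "?f m \<in> carrier M" using rmod_homD(1)[OF f m] .
        \<comment> \<open>Both sides equal \<open>u m\<close>; cancelling \<open>u (k m)\<close>
          leaves the required identity.\<close>
        have "u (k m) \<oplus>\<^bsub>X\<^esub> g (u m) = u (k m) \<oplus>\<^bsub>X\<^esub> u (?f m)"
          using hg[OF u.hom_closed[OF m]] k(2)[OF m] kf[OF m] u.hom_add[OF kc[OF m] fm] by simp
        then show ?thesis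
          using u.hom_closed[OF kc[OF m]] u.hom_closed[OF fm] rmod_homD(1)[OF g u.hom_closed[OF m]]
          by simp
      qed
      then show ?thesis using f by blast
    qed
  qed
  then show ?thesis
    using env by (simp add: endomorphism_invariant_def)
qed

theorem proposition3p7:
  fixes R :: "('a, 'c) ring_scheme"
    and \<X> :: "('a, 'x) module set"
    and M :: "('a, 'm) module"
    and X :: "('a, 'x) module"
    and u :: "'m \<Rightarrow> 'x"
  assumes "ring R"
    and "enveloping_class TYPE('m) R \<X>"
    and "right_module R M"
    and "indecomposable_module R M"
    and "is_envelope R \<X> M X u"
    and "inj_on u (carrier M)"
    and "automorphism_invariant R \<X> M X u"
    and "von_neumann_regular (End_ring R X Quot jacobson_radical (End_ring R X))"
    and "right_self_injective (End_ring R X Quot jacobson_radical (End_ring R X))"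
    and "idempotents_lift_modulo (End_ring R X) (jacobson_radical (End_ring R X))"
  shows "endomorphism_invariant R \<X> M X u \<longleftrightarrow> indecomposable_module R X"
proof -
  \<comment> \<open>Members of an enveloping class are right modules by definition, and an envelope
    is such a member.\<close>
  have "right_module R X"
    using assms(2,5) by (simp add: enveloping_class_def is_envelope_def)
  then show ?thesis
    using endomorphism_invariant_imp_indecomposable indecomposable_imp_endomorphism_invariant assms
    by blast
qed

end
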